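(* Let $d\in\{1,2\}$, $f\in L^2(\mathbb{R}^d)$, and let the ship velocity be constant, $\boldsymbol U(t)=U_x\boldsymbol{e_x}$ with $U_x\in\mathbb{R}$, with position $X(t)=U_x t\,\boldsymbol{e_x}$. Let $\varepsilon\ge0$ and $\hat\mu_{\varepsilon,0}\in L^2(\mathbb{R}^d)$. Then the (mild) solution to $$\frac{d\hat\mu_{\boldsymbol\kappa,\varepsilon}}{dt}(t)=i\omega_{\boldsymbol\kappa,\varepsilon}\hat\mu_{\boldsymbol\kappa,\varepsilon}(t)-\hat g_{\boldsymbol\kappa}(t),\qquad \hat\mu_{\varepsilon}(0)=\hat\mu_{\varepsilon,0},$$ is given, for $t\ge 0$ and a.e. $\boldsymbol\kappa\in\mathbb{R}^d$, by $$\hat\mu_{\boldsymbol\kappa,\varepsilon}(t)=\hat\mu_{\boldsymbol\kappa,\varepsilon}(0)e^{i\omega_{\boldsymbol\kappa,\varepsilon}t}-\frac{D_{\boldsymbol\kappa}}{i(2\pi\kappa_xU_x+\omega_{\boldsymbol\kappa,\varepsilon})}e^{i\omega_{\boldsymbol\kappa,\varepsilon}t}\left(1-e^{-i(2\pi\kappa_xU_x+\omega_{\boldsymbol\kappa,\varepsilon})t}\right),$$ where $$D_{\boldsymbol\kappa}=\frac{2\pi\rho_1\,i\,\kappa_xU_x\hat f_{\boldsymbol\kappa}}{\sinh(2\pi|\boldsymbol\kappa|_2h_1)(T_{1,\boldsymbol\kappa}+T_{2,\boldsymbol\kappa})}.$$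
   Context: Constants: $0<\rho_1<\rho_2$, $h_1,h_2>0$, $g>0$ (gravitational acceleration). $|\cdot|_2$ is the Euclidean norm; $\kappa_x$ is the first component of $\boldsymbol\kappa\in\mathbb{R}^d$ ($\boldsymbol\kappa=\kappa_x$ if $d=1$) and $\boldsymbol{e_x}$ is the unit vector of the $x$-axis. For $\boldsymbol\kappa\ne0$, $$T_{j,\boldsymbol\kappa}=\rho_j\coth(2\pi|\boldsymbol\kappa|_2h_j)\ (j=1,2),\qquad \omega_{\boldsymbol\kappa}=\sqrt{\frac{2\pi|\boldsymbol\kappa|_2(\rho_2-\rho_1)g}{T_{1,\boldsymbol\kappa}+T_{2,\boldsymbol\kappa}}},\qquad \omega_{\boldsymbol\kappa,\varepsilon}=\omega_{\boldsymbol\kappa}+i\varepsilon .$$ $\hat f_{\boldsymbol\kappa}=\int_{\mathbb{R}^d}f(\boldsymbol x)e^{-2\pi i\boldsymbol\kappa\cdot\boldsymbol x}d\boldsymbol x$ is the Fourier transform (extended to $L^2$). The source term is $$\hat g_{\boldsymbol\kappa}(t)=\frac{2\pi\rho_1\, i\,\boldsymbol\kappa\cdot\boldsymbol U(t)\,e^{-2\pi i\boldsymbol\kappa\cdot X(t)}\hat f_{\boldsymbol\kappa}}{\sinh(2\pi|\boldsymbol\kappa|_2h_1)(T_{1,\boldsymbol\kappa}+T_{2,\boldsymbol\kappa})}.$$ The mild solution with initial value in $L^2(\mathbb{R}^d)$ is the function defined by Duhamel's formula $\hat\mu_{\boldsymbol\kappa,\varepsilon}(t)=\hat\mu_{\boldsymbol\kappa,\varepsilon}(0)e^{i\omega_{\boldsymbol\kappa,\varepsilon}t}-\int_0^te^{i\omega_{\boldsymbol\kappa,\varepsilon}(t-\tau)}\hat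 g_{\boldsymbol\kappa}(\tau)d\tau$. When $\varepsilon=0$ and $2\pi\kappa_xU_x+\omega_{\boldsymbol\kappa}=0$, the quotient $\frac{1-e^{-iat}}{ia}$ with $a=2\pi\kappa_xU_x+\omega_{\boldsymbol\kappa}$ is understood by its continuous extension $t$ at $a=0$. *)

theory Defs
  imports "HOL-Analysis.Analysis"
begin

definition L2 :: "('a::euclidean_space \<Rightarrow> complex) set" where
  "L2 = {f. f \<in> borel_measurable lebesgue \<and> integrable lebesgue (\<lambda>x. (norm (f x))\<^sup>2)}"

text \<open>Squared distance in \<open>L\<^sup>2\<close>. It is a nonnegative integral because the Bochner integral of a
  non-integrable function is \<open>0\<close>.\<close>

definition L2_dist2 :: "('a::euclidean_space \<Rightarrow> complex) \<Rightarrow> ('a \<Rightarrow> complex) \<Rightarrow> ennreal" where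
  "L2_dist2 u v = (\<integral>\<^sup>+ x. ennreal ((norm (u x - v x))\<^sup>2) \<partial>lebesgue)"

definition fourier_integral :: "('a::euclidean_space \<Rightarrow> complex) \<Rightarrow> 'a \<Rightarrow> complex" where
  "fourier_integral f \<kappa> =
     (LINT x|lebesgue. f x * exp (- (2 * complex_of_real pi * \<i> * complex_of_real (\<kappa> \<bullet> x))))"

text \<open>\<open>F\<close> represents the Fourier transform of \<open>f \<in> L\<^sup>2\<close>: the transform on \<open>L\<^sup>1 \<inter> L\<^sup>2\<close> is given by
  the integral and extended to \<open>L\<^sup>2\<close> by continuity. Since an element of \<open>L\<^sup>2\<close> is only determined up
  to null sets, this is a relation between \<open>f\<close> and \<open>F\<close>.\<close>

definition has_L2_fourier ::
    "('a::euclidean_space \<Rightarrow> complex) \<Rightarrow> ('a \<Rightarrow> complex) \<Rightarrow> bool" where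
  "has_L2_fourier f F \<longleftrightarrow> f \<in> L2 \<and> F \<in> L2 \<and>
     (\<exists>\<phi> :: nat \<Rightarrow> 'a \<Rightarrow> complex.
        (\<forall>n. \<phi> n \<in> L2 \<and> integrable lebesgue (\<phi> n)) \<and>
        (\<lambda>n. L2_dist2 (\<phi> n) f) \<longlonglongrightarrow> 0 \<and>
        (\<lambda>n. L2_dist2 (fourier_integral (\<phi> n)) F) \<longlonglongrightarrow> 0)"

definition coth :: "real \<Rightarrow> real" where
  "coth x = cosh x / sinh x"

text \<open>The quantities below are meaningful for \<open>\<kappa> \<noteq> 0\<close> only; their value at \<open>\<kappa> = 0\<close> is an artefact of
  division by zero.\<close>

definition T :: "real \<Rightarrow> real \<Rightarrow> 'a::euclidean_space \<Rightarrow> real" where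
  "T \<rho> h \<kappa> = \<rho> * coth (2 * pi * norm \<kappa> * h)"

definition omega ::
    "real \<Rightarrow> real \<Rightarrow> real \<Rightarrow> real \<Rightarrow> real \<Rightarrow> 'a::euclidean_space \<Rightarrow> real" where
  "omega \<rho>1 \<rho>2 h1 h2 g \<kappa> =
     sqrt (2 * pi * norm \<kappa> * (\<rho>2 - \<rho>1) * g / (T \<rho>1 h1 \<kappa> + T \<rho>2 h2 \<kappa>))"

definition omega_eps ::
    "real \<Rightarrow> real \<Rightarrow> real \<Rightarrow> real \<Rightarrow> real \<Rightarrow> real \<Rightarrow> 'a::euclidean_space \<Rightarrow> complex" where
  "omega_eps \<rho>1 \<rho>2 h1 h2 g \<epsilon> \<kappa> =
     complex_of_real (omega \<rho>1 \<rho>2 h1 h2 g \<kappa>) + \<i> * complex_of_real \<epsilon>"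

definition source ::
    "real \<Rightarrow> real \<Rightarrow> real \<Rightarrow> real \<Rightarrow> ('a::euclidean_space \<Rightarrow> complex) \<Rightarrow>
     (real \<Rightarrow> 'a) \<Rightarrow> (real \<Rightarrow> 'a) \<Rightarrow> real \<Rightarrow> 'a \<Rightarrow> complex" where
  "source \<rho>1 \<rho>2 h1 h2 fhat U X t \<kappa> =
     2 * complex_of_real pi * complex_of_real \<rho>1 * \<i> * complex_of_real (\<kappa> \<bullet> U t) *
       exp (- (2 * complex_of_real pi * \<i> * complex_of_real (\<kappa> \<bullet> X t))) * fhat \<kappa> /
     complex_of_real (sinh (2 * pi * norm \<kappa> * h1) * (T \<rho>1 h1 \<kappa> + T \<rho>2 h2 \<kappa>))"

text \<open>Duhamel's formula for \<open>d\<mu>/dt = \<i> w \<mu> - G\<close>, \<open>\<mu>(0) = \<mu>0\<close>, separately at every frequency \<open>\<kappa>\<close>.\<close>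

definition duhamel_integrand ::
    "('a \<Rightarrow> complex) \<Rightarrow> (real \<Rightarrow> 'a \<Rightarrow> complex) \<Rightarrow> real \<Rightarrow> 'a \<Rightarrow> real \<Rightarrow> complex" where
  "duhamel_integrand w G t \<kappa> \<tau> = exp (\<i> * w \<kappa> * complex_of_real (t - \<tau>)) * G \<tau> \<kappa>"

definition mild_solution ::
    "('a \<Rightarrow> complex) \<Rightarrow> (real \<Rightarrow> 'a \<Rightarrow> complex) \<Rightarrow> ('a \<Rightarrow> complex) \<Rightarrow> real \<Rightarrow> 'a \<Rightarrow> complex" where
  "mild_solution w G \<mu>0 t \<kappa> =
     \<mu>0 \<kappa> * exp (\<i> * w \<kappa> * complex_of_real t)
       - (LINT \<tau>:{0..t}|lborel. duhamel_integrand w G t \<kappa> \<tau>)"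

definition D ::
    "real \<Rightarrow> real \<Rightarrow> real \<Rightarrow> real \<Rightarrow> ('a::euclidean_space \<Rightarrow> complex) \<Rightarrow> 'a \<Rightarrow> real \<Rightarrow> 'a \<Rightarrow> complex" where
  "D \<rho>1 \<rho>2 h1 h2 fhat e\<^sub>x U\<^sub>x \<kappa> =
     2 * complex_of_real pi * complex_of_real \<rho>1 * \<i> * complex_of_real ((\<kappa> \<bullet> e\<^sub>x) * U\<^sub>x) * fhat \<kappa> /
     complex_of_real (sinh (2 * pi * norm \<kappa> * h1) * (T \<rho>1 h1 \<kappa> + T \<rho>2 h2 \<kappa>))"

text \<open>\<open>(1 - exp (- \<i> a t)) / (\<i> a)\<close>, extended continuously to \<open>a = 0\<close>.\<close>

definition exp_quotient :: "complex \<Rightarrow> real \<Rightarrow> complex" where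
  "exp_quotient a t =
     (if a = 0 then complex_of_real t
      else (1 - exp (- (\<i> * a * complex_of_real t))) / (\<i> * a))"

end

theory Submission
  imports Defs
begin

text \<open>Frequencies decouple, so the formula is a scalar computation at each \<kappa>. At
  constant velocity the source depends on time only through the phase
  \<open>exp (- 2 pi i kappa_x U_x tau)\<close>. Against the Duhamel kernel this leaves
  \<open>D * exp (i w t)\<close>, constant in \<tau>, times \<open>exp (- i a tau)\<close> with
  \<open>a = 2 pi kappa_x U_x + w\<close> (\<open>duhamel_integrand_source\<close>). Integrating
  this exponential over \<open>{0..t}\<close> produces \<open>exp_quotient a t\<close>
  (\<open>set_lborel_integral_exp\<close>). Resonance, \<open>a = 0\<close>, can occur only if
  \<epsilon> = 0; there the integrand is constant and the continuous extension is the true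
  integral.\<close>

lemma set_lborel_integral_exp:
  fixes a :: complex and t :: real
  assumes "0 \<le> t"
  shows "(LINT \<tau>:{0..t}|lborel. exp (- (\<i> * a * complex_of_real \<tau>))) = exp_quotient a t"
proof -
  \<comment> \<open>An antiderivative for both cases: at \<open>a = 0\<close> the integrand is
    1.\<close>
  define F where "F \<tau> = (if a = 0 then complex_of_real \<tau>
    else - exp (- (\<i> * a * complex_of_real \<tau>)) / (\<i> * a))" for \<tau> :: real
  have "(F has_vector_derivative exp (- (\<i> * a * complex_of_real \<tau>))) (at \<tau> within {0..t})" for \<tau>
  proof (cases "a = 0")
    case True
    then show ?thesis
      unfolding F_def by (auto intro!: derivative_eq_intros)
  next
    case False
    \<comment> \<open>The antiderivative is entire in \<open>z\<close>, so its complex derivative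
      restricts to the real line.\<close>
    have "((\<lambda>z. - exp (- (\<i> * a * z)) / (\<i> * a)) has_field_derivative
        exp (- (\<i> * a * complex_of_real \<tau>))) (at (complex_of_real \<tau>))"
      using False by (auto intro!: derivative_eq_intros)
    then show ?thesis
      unfolding F_def using False
      by (auto dest!: has_vector_derivative_real_field)
  qed
  moreover have "continuous_on {0..t} (\<lambda>\<tau>. exp (- (\<i> * a * complex_of_real \<tau>)))"
    by (intro continuous_intros)
  ultimately have "(LINT \<tau>:{0..t}|lborel. exp (- (\<i> * a * complex_of_real \<tau>))) = F t - F 0"
    unfolding set_lebesgue_integral_def
    using assms by (intro integral_FTC_atLeastAtMost) auto
  also have "\<dots> = exp_quotient a t"
    by (simp add: F_def exp_quotient_def divide_simps)
  finally show ?thesis .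
qed

text \<open>Since \<open>X\<close> is linear in time, the exponents of the kernel and of the moving
  phase add up to a term in \<open>t\<close> plus a term linear in \<tau>; since \<open>U\<close> is
  constant, the other factors of the source are exactly \<open>D\<close>.\<close>

lemma duhamel_integrand_source:
  fixes e\<^sub>x \<kappa> :: "'a::euclidean_space" and w :: "'a \<Rightarrow> complex"
  assumes "\<And>s. U s = U\<^sub>x *\<^sub>R e\<^sub>x" "\<And>s. X s = (U\<^sub>x * s) *\<^sub>R e\<^sub>x"
  shows "duhamel_integrand w (source \<rho>1 \<rho>2 h1 h2 fhat U X) t \<kappa> \<tau> =
    D \<rho>1 \<rho>2 h1 h2 fhat e\<^sub>x U\<^sub>x \<kappa> * exp (\<i> * w \<kappa> * complex_of_real t) *
    exp (- (\<i> * (complex_of_real (2 * pi * (\<kappa> \<bullet> e\<^sub>x) * U\<^sub>x) + w \<kappa>) * complex_of_real \<tau>))"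
proof -
  have "exp (\<i> * w \<kappa> * complex_of_real (t - \<tau>)) *
      exp (- (2 * complex_of_real pi * \<i> * complex_of_real (\<kappa> \<bullet> X \<tau>))) =
      exp (\<i> * w \<kappa> * complex_of_real t) *
      exp (- (\<i> * (complex_of_real (2 * pi * (\<kappa> \<bullet> e\<^sub>x) * U\<^sub>x) + w \<kappa>) * complex_of_real \<tau>))"
    by (simp add: assms exp_add [symmetric] algebra_simps)
  then show ?thesis
    by (simp add: duhamel_integrand_def source_def D_def assms(1) mult_ac)
qed

theorem proposition12:
  fixes \<rho>1 \<rho>2 h1 h2 g \<epsilon> U\<^sub>x t :: real
    and f fhat \<mu>0 :: "'a::euclidean_space \<Rightarrow> complex"
    and e\<^sub>x :: 'a
    and U X :: "real \<Rightarrow> 'a"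
  assumes "0 < \<rho>1" "\<rho>1 < \<rho>2" "0 < h1" "0 < h2" "0 < g"
    and "DIM('a) \<in> {1, 2}" "e\<^sub>x \<in> Basis"
    and "f \<in> L2" "has_L2_fourier f fhat"
    and "\<And>s. U s = U\<^sub>x *\<^sub>R e\<^sub>x" "\<And>s. X s = (U\<^sub>x * s) *\<^sub>R e\<^sub>x"
    and "0 \<le> \<epsilon>" "\<mu>0 \<in> L2"
    and "0 \<le> t"
  shows "AE \<kappa> in lebesgue.
    let w = omega_eps \<rho>1 \<rho>2 h1 h2 g \<epsilon>;
        G = source \<rho>1 \<rho>2 h1 h2 fhat U X
    in set_integrable lborel {0..t} (duhamel_integrand w G t \<kappa>) \<and>
       mild_solution w G \<mu>0 t \<kappa> =
         \<mu>0 \<kappa> * exp (\<i> * w \<kappa> * complex_of_real t)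
           - D \<rho>1 \<rho>2 h1 h2 fhat e\<^sub>x U\<^sub>x \<kappa> * exp (\<i> * w \<kappa> * complex_of_real t)
             * exp_quotient (complex_of_real (2 * pi * (\<kappa> \<bullet> e\<^sub>x) * U\<^sub>x) + w \<kappa>) t"
\<comment> \<open>The identity holds at every \<kappa>. At \<kappa> = 0 the common denominator of
  the source and \<open>D\<close> vanishes, so both are 0 by the convention for division, and only
  the free evolution of the initial value remains.\<close>
proof (rule AE_I2)
  fix \<kappa> :: 'a
  define w where "w = omega_eps \<rho>1 \<rho>2 h1 h2 g \<epsilon> \<kappa>"
  note integrand = duhamel_integrand_source [OF assms(10,11)]
  have "set_integrable lborel {0..t}
      (duhamel_integrand (omega_eps \<rho>1 \<rho>2 h1 h2 g \<epsilon>) (source \<rho>1 \<rho>2 h1 h2 fhat U X) t \<kappa>)"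
    \<comment> \<open>In factored form the integrand is visibly continuous in \<tau>, hence
      integrable on the compact interval.\<close>
    unfolding integrand [abs_def]
    by (intro borel_integrable_atLeastAtMost' continuous_intros)
  moreover have "(LINT \<tau>:{0..t}|lborel.
      duhamel_integrand (omega_eps \<rho>1 \<rho>2 h1 h2 g \<epsilon>) (source \<rho>1 \<rho>2 h1 h2 fhat U X) t \<kappa> \<tau>) =
      D \<rho>1 \<rho>2 h1 h2 fhat e\<^sub>x U\<^sub>x \<kappa> * exp (\<i> * w * complex_of_real t) *
      exp_quotient (complex_of_real (2 * pi * (\<kappa> \<bullet> e\<^sub>x) * U\<^sub>x) + w) t"
    unfolding integrand w_def
    by (simp only: set_integral_mult_right set_lborel_integral_exp [OF \<open>0 \<le> t\<close>])
  ultimately show "let w = omega_eps \<rho>1 \<rho>2 h1 h2 g \<epsilon>;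
        G = source \<rho>1 \<rho>2 h1 h2 fhat U X
    in set_integrable lborel {0..t} (duhamel_integrand w G t \<kappa>) \<and>
       mild_solution w G \<mu>0 t \<kappa> =
         \<mu>0 \<kappa> * exp (\<i> * w \<kappa> * complex_of_real t)
           - D \<rho>1 \<rho>2 h1 h2 fhat e\<^sub>x U\<^sub>x \<kappa> * exp (\<i> * w \<kappa> * complex_of_real t)
             * exp_quotient (complex_of_real (2 * pi * (\<kappa> \<bullet> e\<^sub>x) * U\<^sub>x) + w \<kappa>) t"
    by (simp add: Let_def mild_solution_def w_def)
qed

end
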